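(* There are posets with local dimension $4$ and unbounded boolean dimension. That is, for every positive integer $m$ there exists a poset whose local dimension is $4$ and whose boolean dimension is greater than $m$.
   Context: Let $P=(X,\leq)$ be a poset. Boolean dimension: a boolean realizer of $P$ is a set $\{\leq_1,\ldots,\leq_d\}$ of (arbitrary) linear orders on $X$ for which there is a $d$-ary boolean formula $\phi$ such that for all $x,y\in X$: $x\leq y$ if and only if $\phi\bigl((x\leq_1 y),\ldots,(x\leq_d y)\bigr)$ is true, where $(x\leq_i y)$ denotes the truth value of $x\leq_i y$. The boolean dimension of $P$ is the minimum size of a boolean realizer of $P$. Local dimension: a partial linear extension of $\leq$ is a linear extension of the restriction of $\leq$ to some subset of $X$. A local realizer of $P$ of width $d$ is a set $\{\leq_1,\ldots,\leq_t\}$ of partial linear extensions of $\leq$ such that every element of $X$ occurs in (the ground sets of) at most $d$ of $\leq_1,\ldots,\leq_t$, and for all $x,y\in X$: $x\leq y$ if and only if there is no $i\in\{1,\ldots,t\}$ with $x>_i y$ (where $x>_i y$ means that both $x$ and $y$ occur in $\leq_i$ and $x$ is strictly greater than $y$ there). The local dimension of $P$ is the minimum width of a local realizer of $P$. *)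

theory Defs
  imports Main "HOL-Library.Extended_Nat"
begin

text \<open>
  A poset is a carrier \<open>X\<close> with a relation \<open>r\<close> such that
  \<^prop>\<open>partial_order_on X r\<close>, where \<open>(x, y) \<in> r\<close> means \<open>x \<le> y\<close>.
\<close>

datatype (vars: 'v) bform =
    Var 'v
  | Const bool
  | Neg "'v bform"
  | Conj "'v bform" "'v bform"
  | Disj "'v bform" "'v bform"

primrec holds :: "('v \<Rightarrow> bool) \<Rightarrow> 'v bform \<Rightarrow> bool" where
  "holds \<alpha> (Var v) \<longleftrightarrow> \<alpha> v"
| "holds \<alpha> (Const b) \<longleftrightarrow> b"
| "holds \<alpha> (Neg \<phi>) \<longleftrightarrow> \<not> holds \<alpha> \<phi>"
| "holds \<alpha> (Conj \<phi> \<psi>) \<longleftrightarrow> holds \<alpha> \<phi> \<and> holds \<alpha> \<psi>"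
| "holds \<alpha> (Disj \<phi> \<psi>) \<longleftrightarrow> holds \<alpha> \<phi> \<or> holds \<alpha> \<psi>"

text \<open>
  The list \<open>Ls\<close> enumerates the realizer; variable \<open>i\<close> (counted from 0)
  of the formula stands for the truth value of \<open>x \<le> y\<close> in the order \<open>Ls ! i\<close>.
\<close>

definition boolean_realizer :: "'a set \<Rightarrow> 'a rel \<Rightarrow> 'a rel set \<Rightarrow> bool" where
  "boolean_realizer X r R \<longleftrightarrow>
     finite R \<and> (\<forall>L\<in>R. linear_order_on X L) \<and>
     (\<exists>Ls \<phi>. set Ls = R \<and> distinct Ls \<and> vars \<phi> \<subseteq> {..<length Ls} \<and>
        (\<forall>x\<in>X. \<forall>y\<in>X. (x, y) \<in> r \<longleftrightarrow> holds (\<lambda>i. (x, y) \<in> Ls ! i) \<phi>))"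

text \<open>The value is \<open>\<infinity>\<close> if there is no (finite) boolean realizer.\<close>

definition boolean_dimension :: "'a set \<Rightarrow> 'a rel \<Rightarrow> enat" where
  "boolean_dimension X r = (INF R \<in> {R. boolean_realizer X r R}. enat (card R))"

definition partial_linear_extension :: "'a set \<Rightarrow> 'a rel \<Rightarrow> 'a rel \<Rightarrow> bool" where
  "partial_linear_extension X r L \<longleftrightarrow>
     (\<exists>Y\<subseteq>X. linear_order_on Y L \<and> r \<inter> (Y \<times> Y) \<subseteq> L)"

text \<open>
  The ground set of a linear order \<open>L\<close> is \<^term>\<open>Field L\<close>. Membership
  \<open>(y, x) \<in> L\<close> already forces both elements to occur in \<open>L\<close>.
\<close>

definition local_realizer :: "'a set \<Rightarrow> 'a rel \<Rightarrow> nat \<Rightarrow> 'a rel set \<Rightarrow> bool" where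
  "local_realizer X r d R \<longleftrightarrow>
     finite R \<and> (\<forall>L\<in>R. partial_linear_extension X r L) \<and>
     (\<forall>x\<in>X. card {L\<in>R. x \<in> Field L} \<le> d) \<and>
     (\<forall>x\<in>X. \<forall>y\<in>X. (x, y) \<in> r \<longleftrightarrow> \<not> (\<exists>L\<in>R. (y, x) \<in> L \<and> x \<noteq> y))"

text \<open>The value is \<open>\<infinity>\<close> if there is no (finite) local realizer.\<close>

definition local_dimension :: "'a set \<Rightarrow> 'a rel \<Rightarrow> enat" where
  "local_dimension X r = (INF d \<in> {d. \<exists>R. local_realizer X r d R}. enat d)"

end

theory Submission
  imports Defs "HOL-Library.FuncSet" "HOL-Library.Product_Lexorder" "HOL-Library.Countable"
begin

text \<open>
  Let \<open>Q\<close> be a finite set of points in the plane, ordered by strict dominance, whose cover graph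
  has large chromatic number. Order the covers \<open>(u, v)\<close> of \<open>Q\<close> by \<open>(u, v) < (u', v')\<close> iff
  \<open>u < u'\<close> and \<open>v \<noteq> u'\<close>; this is transitive because nothing lies between \<open>u\<close> and \<open>v\<close>. Two linear
  orders realize the dominance of first components, and for each \<open>c \<in> Q\<close> one partial linear
  extension puts the covers starting in \<open>c\<close> below those ending in \<open>c\<close>; a cover meets only two of
  the latter, so the local dimension is at most 4.

  Given \<open>d\<close> linear orders, color a path \<open>u, v, w\<close> of covers by the truth vector comparing \<open>(u, v)\<close>
  with \<open>(v, w)\<close>. As the chromatic number is large, there is a path \<open>u, v, w, z\<close> with both colors
  equal, and by transitivity the pair \<open>(u, v), (w, z)\<close> has the same truth vector. But the former
  pairs are incomparable and the latter is not, so there is no boolean realizer of size \<open>d\<close>.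

  To make the local dimension exactly 4, a complete bipartite order is put on top and its pairs
  are deleted one at a time: each deletion raises the local dimension by at most one, and by
  counting some subset of deletions raises it above 3.
\<close>

section \<open>Planar point sets with cover graphs of large chromatic number\<close>

definition dominated :: "int \<times> int \<Rightarrow> int \<times> int \<Rightarrow> bool" where
  "dominated p q \<longleftrightarrow> fst p < fst q \<and> snd p < snd q"

definition covers :: "(int \<times> int) set \<Rightarrow> int \<times> int \<Rightarrow> int \<times> int \<Rightarrow> bool" where
  "covers Q p q \<longleftrightarrow> p \<in> Q \<and> q \<in> Q \<and> dominated p q \<and> \<not> (\<exists>z\<in>Q. dominated p z \<and> dominated z q)"

definition proper :: "(int \<times> int) set \<Rightarrow> (int \<times> int \<Rightarrow> 'c) \<Rightarrow> bool" where
  "proper Q f \<longleftrightarrow> (\<forall>p q. covers Q p q \<longrightarrow> f p \<noteq> f q)"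

text \<open>The points that a new point far to the right at height just below \<open>y\<close> would cover.\<close>

definition visible :: "(int \<times> int) set \<Rightarrow> int \<Rightarrow> (int \<times> int) set" where
  "visible Q y = {p \<in> Q. snd p < y \<and> \<not> (\<exists>q\<in>Q. dominated p q \<and> snd q < y)}"

lemma dominated_trans: "dominated p q \<Longrightarrow> dominated q z \<Longrightarrow> dominated p z"
  by (auto simp: dominated_def)

lemma finite_box: "Q \<subseteq> {0..<n} \<times> {0..<n} \<Longrightarrow> finite (Q :: (int \<times> int) set)"
  by (rule finite_subset) auto

lemma proper_comp:
  assumes "proper Q' f" and "\<And>p q. covers Q p q \<Longrightarrow> covers Q' (g p) (g q)"
  shows "proper Q (\<lambda>p. f (g p))"
  using assms unfolding proper_def by blast

text \<open>The column \<open>D\<close> to the right of \<open>Q\<close> has one point for each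
  \<open>y\<close>. Its points do not dominate each other, and point \<open>y\<close> covers the
  copy of all of \<open>visible Q y\<close>; for a suitable \<open>y\<close> its color is therefore
  new beyond \<open>k\<close> visible ones.\<close>

lemma chromatic_from_visible:
  fixes n :: int and Q :: "(int \<times> int) set"
  assumes box: "Q \<subseteq> {0..<n} \<times> {0..<n}" and n: "0 \<le> n"
    and vis: "\<And>f :: int \<times> int \<Rightarrow> 'c. proper Q f \<Longrightarrow> \<exists>y\<in>{0..n}. k \<le> card (f ` visible Q y)"
  shows "\<exists>g>0. \<exists>G\<subseteq>{0..<g} \<times> {0..<g}. \<forall>f :: int \<times> int \<Rightarrow> 'c. proper G f \<longrightarrow> Suc k \<le> card (f ` G)"
proof -
  \<comment> \<open>Doubling makes the even height \<open>2 * y\<close> separate the old heights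
    below \<open>y\<close> from the others.\<close>
  define old :: "int \<times> int \<Rightarrow> int \<times> int" where "old = (\<lambda>(x, h). (x, 2 * h + 1))"
  define D where "D = (\<lambda>y. (n, 2 * y)) ` {0..n}"
  define G where "G = old ` Q \<union> D"
  have G: "G \<subseteq> {0..<2*n+1} \<times> {0..<2*n+1}"
    using box n by (fastforce simp: G_def old_def D_def)
  have oldD: "fst (old p) = fst p" "snd (old p) = 2 * snd p + 1" for p
    by (auto simp: old_def split: prod.splits)
  have dom_old: "dominated (old p) (old q) \<longleftrightarrow> dominated p q" for p q
    by (auto simp: dominated_def oldD)
  have lt: "fst p < n" if "p \<in> Q" for p using that box by auto
  have cov_old: "covers G (old p) (old q)" if c: "covers Q p q" for p q
  proof -
    have pq: "p \<in> Q" "q \<in> Q" "dominated p q" using c by (auto simp: covers_def)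
    have "False" if z: "z \<in> G" "dominated (old p) z" "dominated z (old q)" for z
    proof -
      consider w where "w \<in> Q" "z = old w" | "z \<in> D" using z(1) G_def by blast
      then show False
      proof cases
        case 1 then show False using c z(2,3) dom_old by (auto simp: covers_def)
      next
        case 2 then show False using z(3) lt[OF pq(2)] by (auto simp: D_def dominated_def oldD)
      qed
    qed
    then show ?thesis using pq dom_old by (auto simp: covers_def G_def)
  qed
  have "Suc k \<le> card (f ` G)" if f: "proper G f" for f :: "int \<times> int \<Rightarrow> 'c"
  proof -
    let ?f = "\<lambda>p. f (old p)"
    have "proper Q ?f" using proper_comp[OF f] cov_old by blast
    then obtain y where y: "y \<in> {0..n}" "k \<le> card (?f ` visible Q y)" using vis by blast
    let ?d = "(n, 2 * y)"
    have dG: "?d \<in> G" using y by (auto simp: G_def D_def)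
    have cov: "covers G (old p) ?d" if p: "p \<in> visible Q y" for p
    proof -
      have pQ: "p \<in> Q" "snd p < y" using p by (auto simp: visible_def)
      have "False" if z: "z \<in> G" "dominated (old p) z" "dominated z ?d" for z
      proof -
        consider w where "w \<in> Q" "z = old w" | "z \<in> D" using z(1) G_def by blast
        then show False
        proof cases
          case 1
          then have "dominated p w" "snd w < y" using z dom_old by (auto simp: dominated_def oldD)
          then show False using p 1 by (auto simp: visible_def)
        next
          case 2 then show False using z(3) by (auto simp: D_def dominated_def)
        qed
      qed
      then show ?thesis using pQ lt[OF pQ(1)] dG by (auto simp: covers_def G_def dominated_def oldD)
    qed
    have "f ?d \<notin> ?f ` visible Q y" using cov f unfolding proper_def by (metis (no_types, lifting) imageE)
    moreover have fin: "finite (?f ` visible Q y)"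
      using finite_box[OF box] by (auto simp: visible_def)
    ultimately have "Suc k \<le> card (insert (f ?d) (?f ` visible Q y))" using y by simp
    also have "\<dots> \<le> card (f ` G)"
      using dG finite_box[OF G] by (intro card_mono) (auto simp: G_def visible_def)
    finally show ?thesis .
  qed
  moreover have "2 * n + 1 > 0" using n by simp
  ultimately show ?thesis using G by blast
qed

text \<open>A copy of \<open>G\<close> is placed to the left of \<open>Q\<close> in every height slot between points of \<open>Q\<close>. Since it
  is left of \<open>Q\<close>, it hides no point of \<open>Q\<close> from the right, and each of its points is visible at the
  height just above it. If \<open>k\<close> colors of \<open>Q\<close> are visible in a slot, the copy of \<open>G\<close> there has a
  further color.\<close>

lemma visible_step:
  fixes n g :: int and Q G :: "(int \<times> int) set"
  assumes box: "Q \<subseteq> {0..<n} \<times> {0..<n}" and n: "0 \<le> n" and g: "0 < g"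
    and vis: "\<And>f :: int \<times> int \<Rightarrow> 'c. proper Q f \<Longrightarrow> \<exists>y\<in>{0..n}. k \<le> card (f ` visible Q y)"
    and boxG: "G \<subseteq> {0..<g} \<times> {0..<g}"
    and chrom: "\<And>f :: int \<times> int \<Rightarrow> 'c. proper G f \<Longrightarrow> Suc k \<le> card (f ` G)"
  shows "\<exists>n' Q'. 0 \<le> n' \<and> Q' \<subseteq> {0..<n'} \<times> {0..<n'} \<and>
    (\<forall>f :: int \<times> int \<Rightarrow> 'c. proper Q' f \<longrightarrow> (\<exists>y\<in>{0..n'}. Suc k \<le> card (f ` visible Q' y)))"
proof -
  \<comment> \<open>Copy \<open>y\<close> of \<open>G\<close> occupies the heights
    \<open>(g + 1) * y\<close> to \<open>(g + 1) * y + g - 1\<close>, above the old points of height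
    below \<open>y\<close> and below all other old points. The shift by \<open>g\<close> keeps
    \<open>Q\<close> to the right of every copy.\<close>
  define old :: "int \<times> int \<Rightarrow> int \<times> int" where "old = (\<lambda>(x, h). (x + g, (g + 1) * h + g))"
  define new :: "int \<Rightarrow> int \<times> int \<Rightarrow> int \<times> int" where "new = (\<lambda>y (x, h). (x, (g + 1) * y + h))"
  define Q' where "Q' = old ` Q \<union> (\<Union>y\<in>{0..n}. new y ` G)"
  define n' where "n' = (g + 1) * (n + 1)"
  have oldD: "fst (old p) = fst p + g" "snd (old p) = (g + 1) * snd p + g" for p
    by (auto simp: old_def split: prod.splits)
  have newD: "fst (new y p) = fst p" "snd (new y p) = (g + 1) * y + snd p" for y p
    by (auto simp: new_def split: prod.splits)
  have mono: "(g + 1) * a + (g + 1) \<le> (g + 1) * b" if "a < b" for a b :: int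
  proof -
    have "(g + 1) * (a + 1) \<le> (g + 1) * b" using that g by (intro mult_left_mono) auto
    then show ?thesis by (simp add: algebra_simps)
  qed
  have mono': "(g + 1) * a \<le> (g + 1) * b" if "a \<le> b" for a b :: int
    using that g by (intro mult_left_mono) auto
  have lt: "0 \<le> fst p" "fst p < n" "0 \<le> snd p" "snd p < n" if "p \<in> Q" for p using that box by auto
  have ltG: "0 \<le> fst p" "fst p < g" "0 \<le> snd p" "snd p < g" if "p \<in> G" for p using that boxG by auto
  have n'_eq: "n' = (g + 1) * n + (g + 1)" by (simp add: n'_def algebra_simps)
  have gn: "n \<le> (g + 1) * n" "0 \<le> (g + 1) * n" using n g by (auto simp: algebra_simps)
  have box': "Q' \<subseteq> {0..<n'} \<times> {0..<n'}"
  proof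
    fix z assume "z \<in> Q'"
    then consider p where "p \<in> Q" "z = old p" | y p where "y \<in> {0..n}" "p \<in> G" "z = new y p"
      unfolding Q'_def by blast
    then show "z \<in> {0..<n'} \<times> {0..<n'}"
    proof cases
      case 1
      show ?thesis
        using lt[OF 1(1)] mono[OF lt(4)[OF 1(1)]] mono'[OF lt(3)[OF 1(1)]] g gn
        unfolding 1 mem_Times_iff oldD n'_eq atLeastLessThan_iff by (intro conjI; linarith)
    next
      case 2
      show ?thesis
        using ltG[OF 2(2)] mono'[of y n] mono'[of 0 y] 2(1) g gn
        unfolding 2 mem_Times_iff newD n'_eq atLeastLessThan_iff atLeastAtMost_iff
        by (intro conjI; linarith)
    qed
  qed
  have old_less: "snd (old p) < snd (old q) \<longleftrightarrow> snd p < snd q" for p q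
    using mono'[of "snd q" "snd p"] mono[of "snd p" "snd q"] g by (auto simp: oldD not_less)
  have dom_old: "dominated (old p) (old q) \<longleftrightarrow> dominated p q" for p q
    using old_less[of p q] by (auto simp: dominated_def oldD)
  have dom_new: "dominated (new y p) (new y q) \<longleftrightarrow> dominated p q" for y p q
    by (auto simp: dominated_def newD)
  have not_old_new: "\<not> dominated (old p) (new y q)" if "p \<in> Q" "q \<in> G" for y p q
    using lt[OF that(1)] ltG[OF that(2)] by (auto simp: dominated_def oldD newD)
  have Q'_cases: "(\<exists>w\<in>Q. z = old w) \<or> (\<exists>y\<in>{0..n}. \<exists>w\<in>G. z = new y w)" if "z \<in> Q'" for z
    using that unfolding Q'_def by blast
  have cov_old: "covers Q' (old p) (old q)" if c: "covers Q p q" for p q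
  proof -
    have pq: "p \<in> Q" "q \<in> Q" "dominated p q" using c by (auto simp: covers_def)
    have "False" if z: "z \<in> Q'" "dominated (old p) z" "dominated z (old q)" for z
      using Q'_cases[OF z(1)] z(2,3) c not_old_new[OF pq(1)] dom_old unfolding covers_def by metis
    moreover have "old p \<in> Q'" "old q \<in> Q'" using pq by (auto simp: Q'_def)
    ultimately show ?thesis using pq dom_old unfolding covers_def by blast
  qed
  have cov_new: "covers Q' (new y p) (new y q)" if y: "y \<in> {0..n}" and c: "covers G p q" for y p q
  proof -
    have pq: "p \<in> G" "q \<in> G" "dominated p q" using c by (auto simp: covers_def)
    have "False" if z: "z \<in> Q'" "dominated (new y p) z" "dominated z (new y q)" for z
      using Q'_cases[OF z(1)]
    proof (elim disjE bexE)
      fix w assume "w \<in> Q" "z = old w" then show False using z(3) not_old_new pq(2) by blast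
    next
      fix y' w assume w: "y' \<in> {0..n}" "w \<in> G" "z = new y' w"
      have "(g + 1) * y + snd p < (g + 1) * y' + snd w" "(g + 1) * y' + snd w < (g + 1) * y + snd q"
        using z(2,3) w(3) by (auto simp: dominated_def newD)
      then have "y' = y"
        using mono[of y y'] mono[of y' y] ltG[OF w(2)] ltG[OF pq(1)] ltG[OF pq(2)]
        by (cases y y' rule: linorder_cases) linarith+
      then show False using z(2,3) w c dom_new unfolding covers_def by blast
    qed
    moreover have "new y p \<in> Q'" "new y q \<in> Q'" using pq y by (auto simp: Q'_def)
    ultimately show ?thesis using pq dom_new unfolding covers_def by blast
  qed
  have "\<exists>y\<in>{0..n'}. Suc k \<le> card (f ` visible Q' y)" if f: "proper Q' f" for f :: "int \<times> int \<Rightarrow> 'c"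
  proof -
    have "proper Q (\<lambda>p. f (old p))" using proper_comp[OF f] cov_old by blast
    then obtain y where y: "y \<in> {0..n}" and k: "k \<le> card ((\<lambda>p. f (old p)) ` visible Q y)"
      using vis by blast
    let ?A = "(\<lambda>p. f (old p)) ` visible Q y" and ?B = "(\<lambda>p. f (new y p)) ` G"
    have "proper G (\<lambda>p. f (new y p))" using proper_comp[OF f] cov_new[OF y] by blast
    then have B: "Suc k \<le> card ?B" using chrom by blast
    have finA: "finite ?A" using finite_box[OF box] by (auto simp: visible_def)
    have ex: "\<exists>p\<in>G. Suc k \<le> card (insert (f (new y p)) ?A)"
    \<comment> \<open>If the copy repeats only visible colors, these already number
      \<open>k + 1\<close>, since the copy uses that many; otherwise one of its points supplies a
      new color.\<close>
    proof (cases "?B \<subseteq> ?A")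
      case True
      then have "Suc k \<le> card ?A" using B card_mono[OF finA] le_trans by blast
      then have "Suc k \<le> card (insert (f (new y p)) ?A)" for p by (rule le_trans[OF _ card_insert_le])
      moreover have "?B \<noteq> {}" using B by (metis card.empty not_less_eq_eq zero_le)
      then obtain p where "p \<in> G" by blast
      ultimately show ?thesis by (intro bexI[of _ p])
    next
      case False
      then obtain p where "p \<in> G" "f (new y p) \<notin> ?A" by blast
      then show ?thesis using k finA by (intro bexI[of _ p]) simp_all
    qed
    then obtain p where p: "p \<in> G" "Suc k \<le> card (insert (f (new y p)) ?A)" by blast
    \<comment> \<open>The chosen point of the copy lies just below \<open>h\<close>, so nothing
      below \<open>h\<close> dominates it, while \<open>h\<close> still splits the old heights at
      \<open>y\<close>.\<close>
    define h where "h = (g + 1) * y + snd p + 1"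
    have old_below: "snd (old q) < h \<longleftrightarrow> snd q < y" for q
      using mono[of "snd q" y] mono'[of y "snd q"] ltG[OF p(1)]
      unfolding oldD h_def by (cases "snd q < y"; linarith)
    have "new y p \<in> visible Q' h"
      using p y by (auto simp: visible_def Q'_def h_def newD dominated_def)
    moreover have "old q \<in> visible Q' h" if q: "q \<in> visible Q y" for q
    proof -
      have qQ: "q \<in> Q" "snd q < y" using q by (auto simp: visible_def)
      have "False" if z: "z \<in> Q'" "dominated (old q) z" "snd z < h" for z
        using Q'_cases[OF z(1)] z(2,3) not_old_new[OF qQ(1)] dom_old old_below q
        unfolding visible_def by (metis (mono_tags, lifting) mem_Collect_eq)
      moreover have "old q \<in> Q'" using qQ by (auto simp: Q'_def)
      ultimately show ?thesis using qQ old_below unfolding visible_def by blast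
    qed
    ultimately have "insert (f (new y p)) ?A \<subseteq> f ` visible Q' h" by blast
    moreover have "finite (f ` visible Q' h)" using finite_box[OF box'] by (auto simp: visible_def)
    ultimately have "Suc k \<le> card (f ` visible Q' h)" using p(2) by (meson card_mono le_trans)
    moreover have "h \<in> {0..n'}"
      using mono'[of 0 y] mono'[of y n] y ltG[OF p(1)] g
      unfolding h_def n'_eq atLeastAtMost_iff by linarith
    ultimately show ?thesis by blast
  qed
  moreover have "0 \<le> n'" using gn g by (simp add: n'_eq)
  ultimately show ?thesis using box' by blast
qed

text \<open>The two constructions alternate: \<open>k\<close> visible colors yield a set
  \<open>G\<close> needing \<open>k + 1\<close> colors, and copies of \<open>G\<close> make
  \<open>k + 1\<close> colors visible.\<close>

lemma visible_colors_unbounded: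
  "\<exists>n Q. 0 \<le> n \<and> Q \<subseteq> {0..<n} \<times> {0..<n} \<and>
    (\<forall>f :: int \<times> int \<Rightarrow> 'c. proper Q f \<longrightarrow> (\<exists>y\<in>{0..n}. k \<le> card (f ` visible Q y)))"
proof (induction k)
  case 0
  show ?case by (intro exI[of _ 0] exI[of _ "{}"]) auto
next
  case (Suc k)
  then obtain n :: int and Q where Q: "0 \<le> n" "Q \<subseteq> {0..<n} \<times> {0..<n}"
    "\<And>f :: int \<times> int \<Rightarrow> 'c. proper Q f \<Longrightarrow> \<exists>y\<in>{0..n}. k \<le> card (f ` visible Q y)" by blast
  obtain g :: int and G where G: "0 < g" "G \<subseteq> {0..<g} \<times> {0..<g}"
    "\<And>f :: int \<times> int \<Rightarrow> 'c. proper G f \<Longrightarrow> Suc k \<le> card (f ` G)"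
    using chromatic_from_visible[OF Q(2,1,3)] by blast
  show ?case by (rule visible_step[OF Q(2,1) G(1) Q(3) G(2,3)])
qed

theorem cover_graph_chromatic_unbounded:
  "\<exists>(n::int)>0. \<exists>Q\<subseteq>{0..<n} \<times> {0..<n}.
    \<forall>f :: int \<times> int \<Rightarrow> 'c. proper Q f \<longrightarrow> k < card (f ` Q)"
proof -
  obtain n :: int and Q where Q: "0 \<le> n" "Q \<subseteq> {0..<n} \<times> {0..<n}"
    "\<And>f :: int \<times> int \<Rightarrow> 'c. proper Q f \<Longrightarrow> \<exists>y\<in>{0..n}. k \<le> card (f ` visible Q y)"
    using visible_colors_unbounded by metis
  show ?thesis using chromatic_from_visible[OF Q(2,1,3)] unfolding less_eq_Suc_le by blast
qed

section \<open>Orders of local dimension at most four\<close>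

definition key_order :: "'a set \<Rightarrow> ('a \<Rightarrow> 'k::linorder) \<Rightarrow> 'a rel" where
  "key_order Y key = {(x, y). x \<in> Y \<and> y \<in> Y \<and> key x \<le> key y}"

lemma linear_order_key_order: "inj_on key Y \<Longrightarrow> linear_order_on Y (key_order Y key)"
  unfolding linear_order_on_def partial_order_on_def preorder_on_def
  by (auto simp: key_order_def refl_on_def trans_def antisym_def total_on_def inj_on_def)

lemma Field_key_order: "Field (key_order Y key) = Y"
  by (auto simp: key_order_def Field_def)

lemma partial_linear_extension_key_order:
  assumes "Y \<subseteq> X" "inj_on key Y"
    and "\<And>x y. (x, y) \<in> r \<Longrightarrow> x \<in> Y \<Longrightarrow> y \<in> Y \<Longrightarrow> key x \<le> key y"
  shows "partial_linear_extension X r (key_order Y key)"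
  unfolding partial_linear_extension_def
proof (intro exI[of _ Y] conjI)
  show "r \<inter> (Y \<times> Y) \<subseteq> key_order Y key" using assms(3) by (auto simp: key_order_def)
qed (use assms linear_order_key_order in auto)

text \<open>The order on covers, coded by naturals. Arbitrary \<open>s\<close> and \<open>t\<close>
  leave room for the added elements that are not covers.\<close>

definition cut_order :: "nat set \<Rightarrow> (nat \<Rightarrow> int \<times> int) \<Rightarrow> (nat \<Rightarrow> int \<times> int) \<Rightarrow> nat rel" where
  "cut_order X s t = {(x, y). x \<in> X \<and> y \<in> X \<and> (x = y \<or> dominated (s x) (s y) \<and> t x \<noteq> s y)}"

text \<open>Reversing the second coordinate and the final tie-break between the two keys makes their
  intersection strict dominance.\<close>

definition key1 :: "(nat \<Rightarrow> int \<times> int) \<Rightarrow> nat \<Rightarrow> int \<times> int \<times> int" where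
  "key1 s x = (fst (s x), - snd (s x), int x)"

definition key2 :: "(nat \<Rightarrow> int \<times> int) \<Rightarrow> nat \<Rightarrow> int \<times> int \<times> int" where
  "key2 s x = (snd (s x), - fst (s x), - int x)"

text \<open>Among elements starting or ending in \<open>c\<close>, the leading entry moves those
  starting in \<open>c\<close> to the bottom; \<open>key1\<close> orders the rest
  compatibly.\<close>

definition key3 :: "(nat \<Rightarrow> int \<times> int) \<Rightarrow> int \<times> int \<Rightarrow> nat \<Rightarrow> int \<times> int \<times> int \<times> int" where
  "key3 s c x = (if s x = c then 0 else 1, key1 s x)"

text \<open>\<open>skip\<close> is what transitivity needs. For covers it holds because no point of
  \<open>Q\<close> lies strictly between \<open>s x\<close> and \<open>t x\<close>.\<close>

locale cut_poset =
  fixes X :: "nat set" and s t :: "nat \<Rightarrow> int \<times> int"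
  assumes finite_X: "finite X"
    and skip: "\<lbrakk>x \<in> X; y \<in> X; z \<in> X; dominated (s x) (s y); dominated (s y) (s z)\<rbrakk> \<Longrightarrow> t x \<noteq> s z"
begin

abbreviation r where "r \<equiv> cut_order X s t"

lemma partial_order_r: "partial_order_on X r"
  unfolding partial_order_on_def preorder_on_def
proof (intro conjI)
  show "trans r"
    unfolding trans_def cut_order_def using dominated_trans skip by blast
qed (auto simp: cut_order_def refl_on_def antisym_def dominated_def)

lemma dominated_if_keys:
  assumes "x \<noteq> y" "key1 s x \<le> key1 s y" "key2 s x \<le> key2 s y"
  shows "dominated (s x) (s y)"
  using assms by (auto simp: key1_def key2_def less_eq_prod_def dominated_def)

lemma local_realizer_four: "\<exists>R. local_realizer X r 4 R"
proof -
  define L1 where "L1 = key_order X (key1 s)"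
  define L2 where "L2 = key_order X (key2 s)"
  define Y where "Y c = {x \<in> X. s x = c \<or> t x = c}" for c
  define M where "M c = key_order (Y c) (key3 s c)" for c
  define R where "R = {L1, L2} \<union> M ` (s ` X \<union> t ` X)"
  have inj1: "inj_on (key1 s) A" and inj2: "inj_on (key2 s) A" and inj3: "inj_on (key3 s c) A" for A c
    by (auto simp: inj_on_def key1_def key2_def key3_def)
  have YX: "Y c \<subseteq> X" for c by (auto simp: Y_def)
  have dom1: "key1 s x \<le> key1 s y" if "dominated (s x) (s y)" for x y
    using that by (auto simp: key1_def less_eq_prod_def dominated_def)
  have dom2: "key2 s x \<le> key2 s y" if "dominated (s x) (s y)" for x y
    using that by (auto simp: key2_def less_eq_prod_def dominated_def)
  have rI1: "key1 s x \<le> key1 s y" and rI2: "key2 s x \<le> key2 s y" if "(x, y) \<in> r" for x y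
    using that dom1 dom2 by (auto simp: cut_order_def)
  \<comment> \<open>The leading entry could reverse distinct elements only if
    \<open>t x = c = s y\<close>, which \<open>r\<close> excludes. The instantiated
    \<open>less_eq_prod_def\<close> unfolds the outer pair only, so that \<open>rI1\<close> applies
    to the \<open>key1\<close> comparison.\<close>
  have rM: "key3 s c x \<le> key3 s c y" if "(x, y) \<in> r" "x \<in> Y c" "y \<in> Y c" for x y c
    using that rI1[of x y] by (auto simp: key3_def less_eq_prod_def[where x = "(_, key1 s x)"] cut_order_def Y_def)
  have ple: "partial_linear_extension X r L" if L: "L \<in> R" for L
  proof -
    consider "L = L1" | "L = L2" | c where "L = M c" using L unfolding R_def by blast
    then show ?thesis
    proof cases
      case 1
      show ?thesis unfolding 1 L1_def by (rule partial_linear_extension_key_order[OF subset_refl inj1 rI1])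
    next
      case 2
      show ?thesis unfolding 2 L2_def by (rule partial_linear_extension_key_order[OF subset_refl inj2 rI2])
    next
      case 3
      show ?thesis unfolding 3 M_def by (rule partial_linear_extension_key_order[OF YX inj3 rM])
    qed
  qed
  have width: "card {L\<in>R. x \<in> Field L} \<le> 4" for x
  proof -
    have "{L\<in>R. x \<in> Field L} \<subseteq> set [L1, L2, M (s x), M (t x)]"
      by (auto simp: R_def M_def Field_key_order Y_def)
    then have "card {L\<in>R. x \<in> Field L} \<le> card (set [L1, L2, M (s x), M (t x)])"
      by (rule card_mono[rotated]) simp
    also have "\<dots> \<le> length [L1, L2, M (s x), M (t x)]" by (rule card_length)
    finally show ?thesis by simp
  qed
  have realizes: "(x, y) \<in> r \<longleftrightarrow> \<not> (\<exists>L\<in>R. (y, x) \<in> L \<and> x \<noteq> y)" if x: "x \<in> X" and y: "y \<in> X" for x y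
  proof
    assume r: "(x, y) \<in> r"
    have False if L: "L \<in> R" "(y, x) \<in> L" "x \<noteq> y" for L
    proof -
      obtain Z where Z: "linear_order_on Z L" "r \<inter> (Z \<times> Z) \<subseteq> L"
        using ple[OF L(1)] unfolding partial_linear_extension_def by blast
      have "L \<subseteq> Z \<times> Z" "antisym L"
        using Z(1) by (auto simp: linear_order_on_def partial_order_on_def preorder_on_def)
      then show False using Z(2) r L(2,3) by (auto dest: antisymD)
    qed
    then show "\<not> (\<exists>L\<in>R. (y, x) \<in> L \<and> x \<noteq> y)" by blast
  next
    assume nL: "\<not> (\<exists>L\<in>R. (y, x) \<in> L \<and> x \<noteq> y)"
    show "(x, y) \<in> r"
    proof (cases "x = y")
      case False
      have "(y, x) \<notin> L1" "(y, x) \<notin> L2" using nL False by (auto simp: R_def)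
      then have dom: "dominated (s x) (s y)"
        using x y by (intro dominated_if_keys[OF False]) (auto simp: L1_def L2_def key_order_def)
      \<comment> \<open>For a pair consecutive at \<open>c = s y\<close>, the leading entry of
        \<open>key3 s c\<close> is 0 at \<open>y\<close> and 1 at \<open>x\<close>, so
        \<open>M c\<close> reverses it.\<close>
      have "t x \<noteq> s y"
      proof
        assume eq: "t x = s y"
        have "s x \<noteq> s y" using dom by (auto simp: dominated_def)
        then have "(y, x) \<in> M (s y)"
          using eq x y by (auto simp: M_def key_order_def Y_def key3_def less_eq_prod_def)
        then show False using nL False y by (auto simp: R_def)
      qed
      then show ?thesis using dom x y by (auto simp: cut_order_def)
    qed (use x in \<open>auto simp: cut_order_def\<close>)
  qed
  have "finite R" using finite_X by (auto simp: R_def)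
  then have "local_realizer X r 4 R"
    unfolding local_realizer_def using ple width realizes by (intro conjI ballI)
  then show ?thesis ..
qed

end

section \<open>Attaining local dimension exactly four\<close>

lemma partial_linear_extension_antimono:
  assumes "partial_linear_extension X r L" "r' \<subseteq> r"
  shows "partial_linear_extension X r' L"
proof -
  obtain Y where "Y \<subseteq> X" "linear_order_on Y L" "r \<inter> (Y \<times> Y) \<subseteq> L"
    using assms(1) unfolding partial_linear_extension_def by (elim exE conjE)
  moreover from this assms(2) have "r' \<inter> (Y \<times> Y) \<subseteq> L" by (meson Int_mono order_refl order_trans)
  ultimately show ?thesis unfolding partial_linear_extension_def by (intro exI[of _ Y] conjI)
qed

text \<open>An extra order on \<open>{a, b}\<close> alone, with \<open>b\<close> below
  \<open>a\<close>, reverses exactly this pair. The old orders still extend the smaller relation,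
  and only \<open>a\<close> and \<open>b\<close> can gain an occurrence.\<close>

lemma local_realizer_remove_pair:
  assumes R: "local_realizer X r d R" and ab: "a \<in> X" "b \<in> X" "a \<noteq> b"
  shows "\<exists>R'. local_realizer X (r - {(a, b)}) (Suc d) R'"
proof -
  define L0 where "L0 = {(b, b), (b, a), (a, a)}"
  have "partial_linear_extension X (r - {(a, b)}) L" if "L \<in> R" for L
    using R that partial_linear_extension_antimono[of X r L "r - {(a, b)}"]
    by (auto simp: local_realizer_def)
  moreover have "partial_linear_extension X (r - {(a, b)}) L0"
    unfolding partial_linear_extension_def linear_order_on_def partial_order_on_def preorder_on_def
    using ab by (intro exI[of _ "{a, b}"])
      (auto simp: L0_def refl_on_def trans_def antisym_def total_on_def)
  moreover have "card {L \<in> insert L0 R. x \<in> Field L} \<le> Suc d" if "x \<in> X" for x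
  proof -
    have fin: "finite R" using R by (simp add: local_realizer_def)
    have "card {L \<in> insert L0 R. x \<in> Field L} \<le> card (insert L0 {L \<in> R. x \<in> Field L})"
      using fin by (intro card_mono) auto
    also have "\<dots> \<le> Suc (card {L \<in> R. x \<in> Field L})" using fin by (simp add: card_insert_if)
    also have "\<dots> \<le> Suc d" using R that by (simp add: local_realizer_def)
    finally show ?thesis .
  qed
  moreover have "(x, y) \<in> r - {(a, b)} \<longleftrightarrow> \<not> (\<exists>L\<in>insert L0 R. (y, x) \<in> L \<and> x \<noteq> y)"
    if xy: "x \<in> X" "y \<in> X" for x y
  proof -
    have "(x, y) \<in> r \<longleftrightarrow> \<not> (\<exists>L\<in>R. (y, x) \<in> L \<and> x \<noteq> y)"
      using R xy unfolding local_realizer_def by simp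
    moreover have "(y, x) \<in> L0 \<and> x \<noteq> y \<longleftrightarrow> x = a \<and> y = b" using ab by (auto simp: L0_def)
    ultimately show ?thesis by auto
  qed
  ultimately have "local_realizer X (r - {(a, b)}) (Suc d) (insert L0 R)"
    using R unfolding local_realizer_def by simp
  then show ?thesis ..
qed

text \<open>The code lists, for each element, labels of the orders containing it together with its
  position in each of them.\<close>

lemma local_realizer_code:
  assumes R: "local_realizer X r d R" and Y: "Y \<subseteq> X" "finite Y"
  shows "\<exists>c\<in>Y \<rightarrow>\<^sub>E {xs. set xs \<subseteq> {..<d * card Y} \<times> {..<card Y} \<and> length xs \<le> d}.
    \<forall>x\<in>Y. \<forall>y\<in>Y. (x, y) \<in> r \<longleftrightarrow>
      \<not> (\<exists>(l, p)\<in>set (c x). \<exists>(l', q)\<in>set (c y). l = l' \<and> q < p)"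
proof -
  define F where "F x = {L\<in>R. x \<in> Field L}" for x
  \<comment> \<open>The rank of \<open>x\<close> in \<open>L\<close> within \<open>Y\<close>: for
    \<open>x\<close> in \<open>Y\<close> it is below \<open>card Y\<close>, and comparing ranks
    recovers \<open>L\<close> on \<open>Y\<close>.\<close>
  define pos where "pos L x = card {z\<in>Y. (z, x) \<in> L \<and> z \<noteq> x}" for L x
  have fin: "finite (F x)" for x using R by (simp add: local_realizer_def F_def)
  have cF: "card (F x) \<le> d" if "x \<in> Y" for x
    using R that Y(1) by (auto simp: local_realizer_def F_def)
  have "card (\<Union>x\<in>Y. F x) \<le> (\<Sum>x\<in>Y. card (F x))" by (rule card_UN_le[OF Y(2)])
  also have "\<dots> \<le> d * card Y" using sum_mono[of Y "\<lambda>x. card (F x)" "\<lambda>_. d"] cF by (simp add: mult.commute)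
  finally have cU: "card (\<Union>x\<in>Y. F x) \<le> d * card Y" .
  obtain lab where lab: "bij_betw lab (\<Union>x\<in>Y. F x) {0..<card (\<Union>x\<in>Y. F x)}"
    using ex_bij_betw_finite_nat[of "\<Union>x\<in>Y. F x"] fin Y(2) by blast
  have lab_less: "lab L < d * card Y" if "L \<in> F x" "x \<in> Y" for L x
  proof -
    have "lab L \<in> {0..<card (\<Union>x\<in>Y. F x)}" using bij_betwE[OF lab] that by blast
    then show ?thesis using cU by simp
  qed
  have lab_inj: "L = L'" if "L \<in> F x" "x \<in> Y" "L' \<in> F y" "y \<in> Y" "lab L = lab L'" for L L' x y
    using bij_betw_imp_inj_on[OF lab] that unfolding inj_on_def by blast
  have pos_less: "pos L x < card Y" if "x \<in> Y" for L x
    unfolding pos_def by (rule psubset_card_mono[OF Y(2)]) (use that in blast)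
  have pos_iff: "pos L y < pos L x \<longleftrightarrow> (y, x) \<in> L \<and> x \<noteq> y"
    if L: "L \<in> F x" "L \<in> F y" and xy: "x \<in> Y" "y \<in> Y" for L x y
  proof -
    obtain Z where lin: "linear_order_on Z L"
      using R L(1) unfolding local_realizer_def partial_linear_extension_def F_def by blast
    then have o: "trans L" "antisym L" "total_on Z L" "refl_on Z L" and sub: "L \<subseteq> Z \<times> Z"
      by (auto simp: linear_order_on_def partial_order_on_def preorder_on_def)
    have Z: "x \<in> Z" "y \<in> Z" using L sub by (auto simp: F_def Field_def)
    have less: "pos L u < pos L v" if uv: "(u, v) \<in> L" "u \<noteq> v" "u \<in> Y" for u v
    proof -
      have "{z\<in>Y. (z, u) \<in> L \<and> z \<noteq> u} \<subset> {z\<in>Y. (z, v) \<in> L \<and> z \<noteq> v}"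
        using uv o(1,2) unfolding trans_def antisym_def by blast
      then show ?thesis unfolding pos_def using Y(2) by (intro psubset_card_mono) auto
    qed
    have "x = y \<or> (x, y) \<in> L \<or> (y, x) \<in> L" using o(3) Z by (auto simp: total_on_def)
    then show ?thesis using less[of x y] less[of y x] xy by (metis less_asym less_irrefl)
  qed
  have "\<exists>xs. set xs = (\<lambda>L. (lab L, pos L x)) ` F x \<and> length xs \<le> d" if "x \<in> Y" for x
  proof -
    have "finite ((\<lambda>L. (lab L, pos L x)) ` F x)" using fin by simp
    from finite_distinct_list[OF this]
    obtain xs where xs: "set xs = (\<lambda>L. (lab L, pos L x)) ` F x" "distinct xs" by (elim exE conjE)
    then have "length xs \<le> d"
      using distinct_card[OF xs(2)] card_image_le[OF fin] cF[OF that] by (metis le_trans)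
    then show ?thesis using xs by blast
  qed
  then obtain c0 where c0: "\<And>x. x \<in> Y \<Longrightarrow> set (c0 x) = (\<lambda>L. (lab L, pos L x)) ` F x \<and> length (c0 x) \<le> d"
    by metis
  \<comment> \<open>Fixing the value \<open>undefined\<close> outside \<open>Y\<close> places the
    code in a finite function space, which is counted later.\<close>
  define c where "c = restrict c0 Y"
  have cset: "set (c x) = (\<lambda>L. (lab L, pos L x)) ` F x" if "x \<in> Y" for x
    using c0 that by (simp add: c_def)
  have "c \<in> Y \<rightarrow>\<^sub>E {xs. set xs \<subseteq> {..<d * card Y} \<times> {..<card Y} \<and> length xs \<le> d}"
  proof
    fix x assume x: "x \<in> Y"
    have "length (c x) \<le> d" using c0 x by (simp add: c_def)
    then show "c x \<in> {xs. set xs \<subseteq> {..<d * card Y} \<times> {..<card Y} \<and> length xs \<le> d}"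
      using cset[OF x] lab_less[OF _ x] pos_less[OF x] by auto
  qed (simp add: c_def)
  moreover have "(x, y) \<in> r \<longleftrightarrow> \<not> (\<exists>(l, p)\<in>set (c x). \<exists>(l', q)\<in>set (c y). l = l' \<and> q < p)"
    if xy: "x \<in> Y" "y \<in> Y" for x y
  proof -
    have "(\<exists>(l, p)\<in>set (c x). \<exists>(l', q)\<in>set (c y). l = l' \<and> q < p) \<longleftrightarrow>
        (\<exists>L\<in>F x. \<exists>L'\<in>F y. lab L = lab L' \<and> pos L' y < pos L x)"
      by (simp add: cset xy)
    also have "\<dots> \<longleftrightarrow> (\<exists>L. L \<in> F x \<and> L \<in> F y \<and> pos L y < pos L x)"
      using lab_inj[OF _ xy(1) _ xy(2)] by blast
    also have "\<dots> \<longleftrightarrow> (\<exists>L\<in>R. (y, x) \<in> L \<and> x \<noteq> y)"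
    proof
      assume "\<exists>L. L \<in> F x \<and> L \<in> F y \<and> pos L y < pos L x"
      then show "\<exists>L\<in>R. (y, x) \<in> L \<and> x \<noteq> y" using pos_iff xy by (auto simp: F_def)
    next
      assume "\<exists>L\<in>R. (y, x) \<in> L \<and> x \<noteq> y"
      then obtain L where L: "L \<in> R" "(y, x) \<in> L" "x \<noteq> y" by blast
      then have "L \<in> F x" "L \<in> F y" by (auto simp: F_def Field_def)
      then show "\<exists>L. L \<in> F x \<and> L \<in> F y \<and> pos L y < pos L x" using pos_iff xy L by blast
    qed
    finally have "(\<exists>(l, p)\<in>set (c x). \<exists>(l', q)\<in>set (c y). l = l' \<and> q < p) \<longleftrightarrow>
      (\<exists>L\<in>R. (y, x) \<in> L \<and> x \<noteq> y)" .
    moreover have "x \<in> X" "y \<in> X" using xy Y(1) by auto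
    then have "(x, y) \<in> r \<longleftrightarrow> \<not> (\<exists>L\<in>R. (y, x) \<in> L \<and> x \<noteq> y)"
      using R unfolding local_realizer_def by simp
    ultimately show ?thesis by (simp only:)
  qed
  ultimately show ?thesis by (intro bexI[of _ c] ballI)
qed

text \<open>There are \<open>a = 3 * 2 ^ 16\<close> possible entries, and the dominant term
  \<open>a ^ 3 = 27 * 2 ^ 48\<close> of the count is below \<open>2 ^ 53\<close>.\<close>

lemma card_codes_le:
  fixes n :: nat
  assumes n: "n = 256"
  shows "finite {xs. set xs \<subseteq> {..<3 * n} \<times> {..<n} \<and> length xs \<le> 3}"
    and "card {xs. set xs \<subseteq> {..<3 * n} \<times> {..<n} \<and> length xs \<le> 3} \<le> 2 ^ 54"
proof -
  show "finite {xs. set xs \<subseteq> {..<3 * n} \<times> {..<n} \<and> length xs \<le> 3}"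
    by (rule finite_lists_length_le) simp
  show "card {xs. set xs \<subseteq> {..<3 * n} \<times> {..<n} \<and> length xs \<le> 3} \<le> 2 ^ 54"
  proof (subst card_lists_length_le)
    have "(\<Sum>i\<le>3. a ^ i) = 1 + a + a ^ 2 + a ^ 3" for a :: nat by (simp add: eval_nat_numeral)
    then show "(\<Sum>i\<le>3. card ({..<3 * n} \<times> {..<n}) ^ i) \<le> 2 ^ 54"
      by (simp add: n card_cartesian_product)
  qed simp
qed

text \<open>There are \<open>2\<^sup>1\<^sup>6\<^sup>3\<^sup>8\<^sup>4\<close> relations but at most \<open>(2\<^sup>5\<^sup>4)\<^sup>2\<^sup>5\<^sup>6 = 2\<^sup>1\<^sup>3\<^sup>8\<^sup>2\<^sup>4\<close> codes.\<close>

lemma exists_no_local_realizer: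
  assumes card: "card A = 128" "card B = 128" and AB: "A \<inter> B = {}" "A \<union> B \<subseteq> X"
    and r: "A \<times> B \<subseteq> r"
  shows "\<exists>E\<subseteq>A \<times> B. \<not> (\<exists>R. local_realizer X (r - (A \<times> B - E)) 3 R)"
proof (rule ccontr)
  assume "\<not> ?thesis"
  then have all: "\<exists>R. local_realizer X (r - (A \<times> B - E)) 3 R" if "E \<subseteq> A \<times> B" for E using that by blast
  define C :: "(nat \<times> nat) list set" where
    "C = {xs. set xs \<subseteq> {..<3 * card (A \<union> B)} \<times> {..<card (A \<union> B)} \<and> length xs \<le> 3}"
  define rep where "rep c x y \<longleftrightarrow>
    \<not> (\<exists>(l::nat, p::nat)\<in>set (c x). \<exists>(l', q)\<in>set (c y). l = l' \<and> q < p)" for c and x y :: 'a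
  have fin: "finite A" "finite B" using card by (auto intro: card_ge_0_finite)
  have n: "card (A \<union> B) = 256" using card fin AB by (simp add: card_Un_disjoint)
  have "\<exists>c\<in>A \<union> B \<rightarrow>\<^sub>E C. \<forall>x\<in>A \<union> B. \<forall>y\<in>A \<union> B. (x, y) \<in> r - (A \<times> B - E) \<longleftrightarrow> rep c x y"
    if E: "E \<subseteq> A \<times> B" for E
  proof -
    obtain R where "local_realizer X (r - (A \<times> B - E)) 3 R" using all[OF E] by blast
    from local_realizer_code[OF this AB(2)] fin show ?thesis unfolding C_def rep_def by simp
  qed
  then obtain c where c: "\<And>E. E \<subseteq> A \<times> B \<Longrightarrow> c E \<in> A \<union> B \<rightarrow>\<^sub>E C"
    and crep: "\<And>E x y. E \<subseteq> A \<times> B \<Longrightarrow> x \<in> A \<union> B \<Longrightarrow> y \<in> A \<union> B \<Longrightarrow>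
      (x, y) \<in> r - (A \<times> B - E) \<longleftrightarrow> rep (c E) x y" by metis
  \<comment> \<open>Since \<open>A \<times> B\<close> lies in \<open>r\<close>, the reduced relation
    restricted to it is \<open>E\<close> itself, so reading it off the code inverts
    \<open>c\<close>.\<close>
  define dec where "dec e = {(x, y). x \<in> A \<and> y \<in> B \<and> rep e x y}" for e
  have "dec (c E) = E" if "E \<subseteq> A \<times> B" for E
    using crep[OF that] that r unfolding dec_def by blast
  then have "inj_on c (Pow (A \<times> B))" by (intro inj_on_inverseI[where g = dec]) blast
  moreover have "c ` Pow (A \<times> B) \<subseteq> A \<union> B \<rightarrow>\<^sub>E C" using c by auto
  moreover have finC: "finite C" and cardC: "card C \<le> 2 ^ 54" using card_codes_le[OF n] unfolding C_def by auto
  moreover have "finite (A \<union> B \<rightarrow>\<^sub>E C)" using fin finC by (intro finite_PiE) auto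
  ultimately have "card (Pow (A \<times> B)) \<le> card (A \<union> B \<rightarrow>\<^sub>E C)" by (metis card_inj_on_le)
  also have "\<dots> = card C ^ 256" using fin n by (simp add: card_funcsetE)
  also have "\<dots> \<le> (2 ^ 54) ^ 256" using cardC by (rule power_mono) simp
  finally have "(2::nat) ^ (128 * 128) \<le> 2 ^ (54 * 256)"
    using fin card by (simp only: card_Pow card_cartesian_product power_mult finite_cartesian_product)
  then have "128 * 128 \<le> (54 * 256 :: nat)" by (rule power_le_imp_le_exp[rotated]) simp
  then show False by simp
qed

text \<open>Width is an upper bound on occurrences, so failure at \<open>d\<close> excludes all
  smaller widths.\<close>

lemma local_dimension_eqI:
  assumes "\<exists>R. local_realizer X r (Suc d) R" "\<not> (\<exists>R. local_realizer X r d R)"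
  shows "local_dimension X r = enat (Suc d)"
proof (rule antisym)
  show "local_dimension X r \<le> enat (Suc d)"
    unfolding local_dimension_def using assms(1) by (intro INF_lower) simp
  have "Suc d \<le> k" if R: "local_realizer X r k R" for k R
  proof (rule ccontr)
    assume "\<not> ?thesis"
    then have "k \<le> d" by simp
    then have "local_realizer X r d R" using R unfolding local_realizer_def by fastforce
    then show False using assms(2) by blast
  qed
  then show "enat (Suc d) \<le> local_dimension X r"
    unfolding local_dimension_def by (intro INF_greatest) auto
qed

text \<open>A deleted pair is no composite of two kept ones: by \<open>cov\<close> the middle
  element would be an endpoint, making one of the two the deleted pair. Disjointness protects
  reflexivity.\<close>

lemma partial_order_on_remove_covers:
  assumes r: "partial_order_on X r" and AB: "A \<inter> B = {}"
    and cov: "\<And>a b z. a \<in> A \<Longrightarrow> b \<in> B \<Longrightarrow> (a, z) \<in> r \<Longrightarrow> (z, b) \<in> r \<Longrightarrow> z = a \<or> z = b"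
    and D: "D \<subseteq> A \<times> B"
  shows "partial_order_on X (r - D)"
proof -
  have o: "r \<subseteq> X \<times> X" "refl_on X r" "trans r" "antisym r"
    using r by (auto simp: partial_order_on_def preorder_on_def)
  have "trans (r - D)"
  proof (rule transI)
    fix x y z assume xyz: "(x, y) \<in> r - D" "(y, z) \<in> r - D"
    then have "(x, z) \<in> r" using o(3) by (meson DiffD1 transD)
    moreover have "(x, z) \<notin> D" using xyz cov[of x z y] D by blast
    ultimately show "(x, z) \<in> r - D" by blast
  qed
  moreover have "refl_on X (r - D)" using o(2) D AB by (auto simp: refl_on_def)
  moreover have "antisym (r - D)" using o(4) by (rule antisym_subset[rotated]) blast
  ultimately show ?thesis using o(1) unfolding partial_order_on_def preorder_on_def by blast
qed

text \<open>Deleting one pair raises the local dimension by at most one, so on the way from \<open>r\<close> to a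
  relation of local dimension at least 4 the value 4 is attained.\<close>

lemma exists_local_dimension_four:
  assumes four: "\<exists>R. local_realizer X r 4 R" and fin: "finite A" "finite B"
    and AB: "A \<inter> B = {}" "A \<union> B \<subseteq> X" "A \<times> B \<subseteq> r"
    and none: "\<exists>E\<subseteq>A \<times> B. \<not> (\<exists>R. local_realizer X (r - (A \<times> B - E)) 3 R)"
  shows "\<exists>D\<subseteq>A \<times> B. local_dimension X (r - D) = 4"
proof -
  define P where "P E \<longleftrightarrow> E \<subseteq> A \<times> B \<and> \<not> (\<exists>R. local_realizer X (r - (A \<times> B - E)) 3 R)" for E
  have "card E < Suc (card (A \<times> B))" if "P E" for E
    using that fin card_mono[of "A \<times> B" E] by (auto simp: P_def less_Suc_eq_le)
  moreover obtain E0 where "P E0" using none P_def by blast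
  \<comment> \<open>A largest set of kept pairs that defeats width 3: keeping one more pair allows
    width 3, and deleting that pair again costs at most one.\<close>
  ultimately obtain E where E: "P E" and max: "\<And>E'. P E' \<Longrightarrow> card E' \<le> card E"
    using ex_has_greatest_nat[of P E0 card "Suc (card (A \<times> B))"] by blast
  have sub: "E \<subseteq> A \<times> B" using E by (simp add: P_def)
  have "\<exists>R. local_realizer X (r - (A \<times> B - E)) 4 R"
  proof (cases "E = A \<times> B")
    case True then show ?thesis using four by simp
  next
    case False
    then obtain a b where ab: "a \<in> A" "b \<in> B" "(a, b) \<notin> E" using sub by auto
    have "finite E" using sub fin finite_subset by blast
    then have "\<not> P (insert (a, b) E)" using max[of "insert (a, b) E"] ab(3) by auto
    then obtain R where R: "local_realizer X (r - (A \<times> B - insert (a, b) E)) 3 R"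
      using sub ab by (auto simp: P_def)
    have "\<exists>R'. local_realizer X (r - (A \<times> B - insert (a, b) E) - {(a, b)}) (Suc 3) R'"
      by (rule local_realizer_remove_pair[OF R]) (use ab AB in auto)
    moreover have "r - (A \<times> B - insert (a, b) E) - {(a, b)} = r - (A \<times> B - E)" using ab by blast
    ultimately show ?thesis by simp
  qed
  then have "local_dimension X (r - (A \<times> B - E)) = enat (Suc 3)"
    using E by (intro local_dimension_eqI) (auto simp: P_def)
  then show ?thesis by (intro exI[of _ "A \<times> B - E"]) (auto simp: numeral_eq_enat)
qed

section \<open>Lower bound on the boolean dimension\<close>

lemma holds_cong: "(\<And>i. i \<in> vars \<phi> \<Longrightarrow> \<alpha> i = \<beta> i) \<Longrightarrow> holds \<alpha> \<phi> = holds \<beta> \<phi>"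
  by (induction \<phi>) auto

text \<open>In each order, equal truth values for \<open>x, y\<close> and \<open>y, z\<close> force
  \<open>x < y < z\<close> or, by totality, \<open>z < y < x\<close>. Either way \<open>x, z\<close>
  gets the same value, so the formula cannot distinguish it from \<open>x, y\<close>.\<close>

lemma boolean_realizer_coloring:
  assumes "boolean_realizer X r R"
  shows "\<exists>c :: 'a \<Rightarrow> 'a \<Rightarrow> nat set. (\<forall>x y. c x y \<subseteq> {..<card R}) \<and>
    (\<forall>x\<in>X. \<forall>y\<in>X. \<forall>z\<in>X. x \<noteq> y \<longrightarrow> y \<noteq> z \<longrightarrow> x \<noteq> z \<longrightarrow> c x y = c y z \<longrightarrow>
      ((x, y) \<in> r \<longleftrightarrow> (x, z) \<in> r))"
proof -
  obtain Ls \<phi> where Ls: "set Ls = R" "distinct Ls" and lin: "\<And>L. L \<in> R \<Longrightarrow> linear_order_on X L"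
    and vars: "vars \<phi> \<subseteq> {..<length Ls}"
    and holds: "\<And>x y. x \<in> X \<Longrightarrow> y \<in> X \<Longrightarrow> (x, y) \<in> r \<longleftrightarrow> holds (\<lambda>i. (x, y) \<in> Ls ! i) \<phi>"
    using assms unfolding boolean_realizer_def by blast
  have len: "length Ls = card R" using Ls distinct_card by force
  define c where "c x y = {i. i < length Ls \<and> (x, y) \<in> Ls ! i}" for x y
  have "(x, y) \<in> r \<longleftrightarrow> (x, z) \<in> r"
    if xyz: "x \<in> X" "y \<in> X" "z \<in> X" "x \<noteq> y" "y \<noteq> z" "x \<noteq> z" and eq: "c x y = c y z" for x y z
  proof -
    have "(x, y) \<in> Ls ! i \<longleftrightarrow> (x, z) \<in> Ls ! i" if i: "i < length Ls" for i
    proof -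
      have "linear_order_on X (Ls ! i)" using lin Ls i nth_mem by blast
      then have o: "trans (Ls ! i)" "antisym (Ls ! i)" "total_on X (Ls ! i)"
        by (auto simp: linear_order_on_def partial_order_on_def preorder_on_def)
      have yz: "(x, y) \<in> Ls ! i \<longleftrightarrow> (y, z) \<in> Ls ! i" using eq i by (auto simp: c_def)
      show ?thesis
      proof (cases "(x, y) \<in> Ls ! i")
        case True then show ?thesis using yz o(1) by (meson transD)
      next
        case False
        then have "(y, x) \<in> Ls ! i" "(z, y) \<in> Ls ! i"
          using o(3) xyz yz unfolding total_on_def by blast+
        then have "(z, x) \<in> Ls ! i" using o(1) by (meson transD)
        then show ?thesis using False o(2) xyz(6) by (meson antisymD)
      qed
    qed
    then have "holds (\<lambda>i. (x, y) \<in> Ls ! i) \<phi> \<longleftrightarrow> holds (\<lambda>i. (x, z) \<in> Ls ! i) \<phi>"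
      using vars by (intro holds_cong) auto
    then show ?thesis using holds xyz by simp
  qed
  moreover have "c x y \<subseteq> {..<card R}" for x y using len by (auto simp: c_def)
  ultimately show ?thesis by (intro exI[of _ c] conjI allI ballI impI) auto
qed

text \<open>A coloring of paths of length two without equally colored consecutive paths yields a proper
  coloring of the vertices by sets of sets of colors.\<close>

lemma path_coloring:
  assumes c: "\<And>u v w z. E u v \<Longrightarrow> E v w \<Longrightarrow> E w z \<Longrightarrow> c u v w \<noteq> c v w z"
    and uv: "E u v"
  shows "(\<lambda>w. c u w ` Collect (E w)) ` Collect (E u) \<noteq> (\<lambda>w. c v w ` Collect (E w)) ` Collect (E v)"
proof
  assume eq: "(\<lambda>w. c u w ` Collect (E w)) ` Collect (E u) = (\<lambda>w. c v w ` Collect (E w)) ` Collect (E v)"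
  \<comment> \<open>Call the colors of the paths starting with an edge its palette. The palette of
    \<open>u v\<close> is also that of some \<open>v w\<close>; it contains the color of
    \<open>u v w\<close>, which is then the color of some \<open>v w z\<close>.\<close>
  have "c u v ` Collect (E v) \<in> (\<lambda>w. c u w ` Collect (E w)) ` Collect (E u)" using uv by simp
  then obtain w where w: "E v w" "c u v ` Collect (E v) = c v w ` Collect (E w)"
    unfolding eq by (elim imageE) simp
  then have "c u v w \<in> c v w ` Collect (E w)" by (metis imageI mem_Collect_eq)
  then obtain z where "E w z" "c u v w = c v w z" by auto
  then show False using c[OF uv w(1)] by simp
qed

text \<open>The three power sets bound truth vectors, palettes of covers and sets of palettes. Only
  three requirements restrict \<open>r\<close>, so the bound survives the deletion of pairs.\<close>

lemma boolean_dimension_greater: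
  fixes e :: "(int \<times> int) \<times> (int \<times> int) \<Rightarrow> 'a"
  assumes "inj e"
    and chrom: "\<And>f :: int \<times> int \<Rightarrow> nat set set set. proper Q f \<Longrightarrow>
      card (Pow (Pow (Pow {..<m}))) < card (f ` Q)"
    and X: "\<And>u v. covers Q u v \<Longrightarrow> e (u, v) \<in> X"
    and incomparable: "\<And>u v w. covers Q u v \<Longrightarrow> covers Q v w \<Longrightarrow> (e (u, v), e (v, w)) \<notin> r"
    and less: "\<And>u v w z. covers Q u v \<Longrightarrow> covers Q v w \<Longrightarrow> covers Q w z \<Longrightarrow>
      (e (u, v), e (w, z)) \<in> r"
  shows "boolean_dimension X r > enat m"
proof -
  have "Suc m \<le> card R" if R: "boolean_realizer X r R" for R
  proof (rule ccontr)
    assume "\<not> ?thesis"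
    then have m: "card R \<le> m" by simp
    obtain c :: "'a \<Rightarrow> 'a \<Rightarrow> nat set" where c: "\<And>x y. c x y \<subseteq> {..<card R}"
      and mono: "\<And>x y z. x \<in> X \<Longrightarrow> y \<in> X \<Longrightarrow> z \<in> X \<Longrightarrow> x \<noteq> y \<Longrightarrow> y \<noteq> z \<Longrightarrow> x \<noteq> z \<Longrightarrow>
        c x y = c y z \<Longrightarrow> (x, y) \<in> r \<longleftrightarrow> (x, z) \<in> r"
      using boolean_realizer_coloring[OF R] by blast
    define d where "d u v w = c (e (u, v)) (e (v, w))" for u v w
    have d: "d u v w \<noteq> d v w z" if cov: "covers Q u v" "covers Q v w" "covers Q w z" for u v w z
    proof
      assume eq: "d u v w = d v w z"
      have "u \<noteq> v" "v \<noteq> w" "u \<noteq> w" using cov by (auto simp: covers_def dominated_def)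
      then have "e (u, v) \<noteq> e (v, w)" "e (v, w) \<noteq> e (w, z)" "e (u, v) \<noteq> e (w, z)"
        using \<open>inj e\<close> by (auto simp: inj_eq)
      then have "(e (u, v), e (v, w)) \<in> r \<longleftrightarrow> (e (u, v), e (w, z)) \<in> r"
        using cov eq by (intro mono X) (simp_all add: d_def)
      then show False using incomparable less cov by blast
    qed
    define f where "f u = (\<lambda>v. d u v ` Collect (covers Q v)) ` Collect (covers Q u)" for u
    have "proper Q f"
      unfolding proper_def f_def by (intro allI impI path_coloring d)
    then have "card (Pow (Pow (Pow {..<m}))) < card (f ` Q)" by (rule chrom)
    moreover have "f ` Q \<subseteq> Pow (Pow (Pow {..<m}))"
    proof -
      have "i < m" if "i \<in> d u v w" for i u v w
        using that c[of "e (u, v)" "e (v, w)"] m by (auto simp: d_def)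
      then show ?thesis unfolding f_def by auto
    qed
    then have "card (f ` Q) \<le> card (Pow (Pow (Pow {..<m})))" by (rule card_mono[rotated]) simp
    ultimately show False by simp
  qed
  then have "enat (Suc m) \<le> boolean_dimension X r"
    unfolding boolean_dimension_def by (intro INF_greatest) simp
  then show ?thesis using less_le_trans[of "enat m" "enat (Suc m)"] by simp
qed

theorem mainTheorem4:
  fixes m :: nat
  assumes "0 < m"
  shows "\<exists>(X :: nat set) (r :: nat rel).
           partial_order_on X r \<and> local_dimension X r = 4 \<and> boolean_dimension X r > enat m"
proof -
  obtain n :: int and Q where n: "0 < n" and box: "Q \<subseteq> {0..<n} \<times> {0..<n}"
    and chrom: "\<And>f :: int \<times> int \<Rightarrow> nat set set set. proper Q f \<Longrightarrow>
      card (Pow (Pow (Pow {..<m}))) < card (f ` Q)"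
    using cover_graph_chromatic_unbounded by metis
  define e :: "(int \<times> int) \<times> (int \<times> int) \<Rightarrow> nat" where "e = to_nat"
  define s t :: "nat \<Rightarrow> int \<times> int" 
    where "s = fst \<circ> (from_nat :: nat \<Rightarrow> (int \<times> int) \<times> (int \<times> int))"
      and "t = snd \<circ> (from_nat :: nat \<Rightarrow> (int \<times> int) \<times> (int \<times> int))"
  have inj: "inj e" by (simp add: e_def)
  have s: "s (e p) = fst p" and t: "t (e p) = snd p" for p by (simp_all add: e_def s_def t_def)
  define C where "C = {(u, v). covers Q u v}"
  \<comment> \<open>The starts \<open>(n, n)\<close> and \<open>(n + 1, n + 1)\<close> dominate all
    of \<open>Q\<close> and put \<open>A\<close> below \<open>B\<close>. The ends have a negative
    abscissa, which no start has, so no pair is cut there; \<open>i\<close> distinguishes the 128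
    copies.\<close>
  define A where "A = (\<lambda>i::int. e ((n, n), (-1 - i, 0))) ` {0..<128}"
  define B where "B = (\<lambda>i::int. e ((n + 1, n + 1), (-1 - i, 0))) ` {0..<128}"
  define X where "X = e ` C \<union> A \<union> B"
  have card: "card A = 128" "card B = 128"
    unfolding A_def B_def by (subst card_image; auto simp: inj_on_def inj_eq[OF inj])+
  have AB: "A \<inter> B = {}" "A \<union> B \<subseteq> X" by (auto simp: A_def B_def X_def inj_eq[OF inj])
  have fin: "finite A" "finite B" by (auto simp: A_def B_def)
  have "C \<subseteq> Q \<times> Q" by (auto simp: C_def covers_def)
  then have finX: "finite X"
    using finite_subset[of C "Q \<times> Q"] finite_box[OF box] fin by (auto simp: X_def)
  have Q_less: "fst u < n" "snd u < n" "0 \<le> fst u" if "u \<in> Q" for u using box that by auto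
  have X_cases: "(\<exists>u v. covers Q u v \<and> s x = u \<and> t x = v) \<or> n \<le> fst (s x) \<and> fst (t x) < 0"
    if "x \<in> X" for x
    using that by (auto simp: X_def A_def B_def C_def s t)
  have s_nonneg: "0 \<le> fst (s x)" if "x \<in> X" for x
    using X_cases[OF that] Q_less n by (auto simp: covers_def)
  interpret cut_poset X s t
  proof
    fix x y z
    assume xyz: "x \<in> X" "y \<in> X" "z \<in> X" and dom: "dominated (s x) (s y)" "dominated (s y) (s z)"
    show "t x \<noteq> s z"
    proof
      assume eq: "t x = s z"
      \<comment> \<open>An end that is also a start has nonnegative abscissa, so \<open>x\<close> is
        a cover. Lying below a point of \<open>Q\<close>, \<open>s y\<close> must be in
        \<open>Q\<close> too, against covering.\<close>
      then have cx: "covers Q (s x) (s z)" using X_cases[OF xyz(1)] s_nonneg[OF xyz(3)] by auto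
      then have "fst (s y) < n" using dom(2) Q_less[of "s z"] by (auto simp: covers_def dominated_def)
      then have "s y \<in> Q" using X_cases[OF xyz(2)] by (auto simp: covers_def)
      then show False using cx dom unfolding covers_def by blast
    qed
  qed (rule finX)
  have ABr: "A \<times> B \<subseteq> r"
    using AB(2) n by (auto simp: cut_order_def A_def B_def s t dominated_def)
  obtain D where D: "D \<subseteq> A \<times> B" and ldim: "local_dimension X (r - D) = 4"
    using exists_local_dimension_four[OF local_realizer_four fin AB ABr
        exists_no_local_realizer[OF card AB ABr]] by blast
  \<comment> \<open>No integer lies strictly between \<open>n\<close> and \<open>n + 1\<close>, so
    no start fits between those of \<open>A\<close> and \<open>B\<close>.\<close>
  have "z = a \<or> z = b" if "a \<in> A" "b \<in> B" "(a, z) \<in> r" "(z, b) \<in> r" for a b z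
    using that by (auto simp: cut_order_def A_def B_def s dominated_def)
  then have order: "partial_order_on X (r - D)"
    using partial_order_on_remove_covers[OF partial_order_r AB(1) _ D] by blast
  have eX: "e (u, v) \<in> X" if "covers Q u v" for u v using that by (auto simp: X_def C_def)
  have "boolean_dimension X (r - D) > enat m"
  proof (rule boolean_dimension_greater[OF inj chrom eX])
    fix u v w assume "covers Q u v" "covers Q v w"
    then show "(e (u, v), e (v, w)) \<notin> r - D"
      by (auto simp: cut_order_def s t inj_eq[OF inj] covers_def dominated_def)
  next
    fix u v w z assume cov: "covers Q u v" "covers Q v w" "covers Q w z"
    then have dom: "dominated u v" "dominated v w" "u \<in> Q" by (auto simp: covers_def)
    then have "dominated u w" "v \<noteq> w" using dominated_trans by (auto simp: dominated_def)
    then have "(e (u, v), e (w, z)) \<in> r" using eX cov by (auto simp: cut_order_def s t)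
    \<comment> \<open>Deleted pairs have their lower element in \<open>A\<close>, so the relation
      between encoded covers is unchanged.\<close>
    moreover have "e (u, v) \<notin> A" using Q_less[OF dom(3)] by (auto simp: A_def inj_eq[OF inj])
    ultimately show "(e (u, v), e (w, z)) \<in> r - D" using D by blast
  qed
  then show ?thesis using order ldim by blast
qed

end
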